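(* For every integer $d \geq 2$, the $(d-2)$-leaky forcing number of the $d$-dimensional hypercube satisfies $Z_{(d-2)}(Q_d) \leq 2^{d-1}$.
   Context: Let $G=(V,E)$ be a finite simple graph. Color change rule: a colored (blue) vertex $v$ colors (forces) an uncolored vertex $u$ if $u$ is the only uncolored neighbor of $v$. In $\ell$-leaky forcing, after an initial set $B\subseteq V$ is colored, an adversary places leaks on at most $\ell$ vertices; a vertex with a leak never forces (it behaves as if it had an extra permanently uncolored neighbor). $B$ is an $\ell$-leaky forcing set if for every placement of at most $\ell$ leaks, repeatedly applying the color change rule (with leaky vertices unable to force) eventually colors all of $V$. The $\ell$-leaky forcing number $Z_{(\ell)}(G)$ is the minimum size of an $\ell$-leaky forcing set; $\ell=0$ is ordinary zero forcing. The hypercube $Q_d$ has vertex set $\{0,1\}^d$, two sequences adjacent iff they differ in exactly one coordinate. *)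

theory Defs
  imports "Graph_Theory.Pair_Digraph"
begin

text \<open>
  Finite simple graphs are instances of the locale \<^locale>\<open>pair_graph\<close>: finitely many vertices,
  no loops, and each edge stored as the two arcs \<open>(u, v)\<close> and \<open>(v, u)\<close>.

  \<open>forces G L S v u\<close> is the color change rule when \<open>S\<close> is the set of colored vertices and \<open>L\<close> the
  set of leaky ones.
\<close>

definition forces :: "'a pair_pre_digraph \<Rightarrow> 'a set \<Rightarrow> 'a set \<Rightarrow> 'a \<Rightarrow> 'a \<Rightarrow> bool" where
  "forces G L S v u \<longleftrightarrow> v \<in> S \<and> v \<notin> L \<and> {w. (v, w) \<in> parcs G \<and> w \<notin> S} = {u}"

inductive force_step :: "'a pair_pre_digraph \<Rightarrow> 'a set \<Rightarrow> 'a set \<Rightarrow> 'a set \<Rightarrow> bool"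
  for G L where
  "forces G L S v u \<Longrightarrow> force_step G L S (insert u S)"

text \<open>
  A force that is available stays available until its target is colored, so the order in which
  forces are carried out is irrelevant: some sequence of forces colors all vertices if and only if
  every maximal sequence does. We use the existential form.
\<close>

definition leaky_forcing_set :: "nat \<Rightarrow> 'a pair_pre_digraph \<Rightarrow> 'a set \<Rightarrow> bool" where
  "leaky_forcing_set l G B \<longleftrightarrow> B \<subseteq> pverts G \<and>
     (\<forall>L \<subseteq> pverts G. card L \<le> l \<longrightarrow> (force_step G L)\<^sup>*\<^sup>* B (pverts G))"

definition leaky_forcing_number :: "nat \<Rightarrow> 'a pair_pre_digraph \<Rightarrow> nat" where
  "leaky_forcing_number l G = (LEAST k. \<exists>B. leaky_forcing_set l G B \<and> card B = k)"

text \<open>The \<^const>\<open>Least\<close> is always attained, because the full vertex set is leaky forcing.\<close>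

lemma leaky_forcing_set_pverts: "leaky_forcing_set l G (pverts G)"
  by (simp add: leaky_forcing_set_def)

lemma leaky_forcing_number_attained:
  "\<exists>B. leaky_forcing_set l G B \<and> card B = leaky_forcing_number l G"
  unfolding leaky_forcing_number_def
  by (rule LeastI_ex) (use leaky_forcing_set_pverts in blast)

definition hypercube :: "nat \<Rightarrow> bool list pair_pre_digraph" where
  "hypercube d =
     \<lparr>pverts = {x. length x = d},
      parcs = {(x, y). length x = d \<and> length y = d \<and> (\<exists>!i. i < d \<and> x ! i \<noteq> y ! i)}\<rparr>"

lemma pair_graph_hypercube: "pair_graph (hypercube d)"
proof
  show "finite (pverts (hypercube d))"
    using finite_lists_length_eq[of "UNIV :: bool set" d] by (simp add: hypercube_def)
  then have "finite (pverts (hypercube d) \<times> pverts (hypercube d))"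
    by simp
  then show "finite (parcs (hypercube d))"
    by (rule rev_finite_subset) (auto simp: hypercube_def)
  have "(y, x) \<in> parcs (hypercube d)" if "(x, y) \<in> parcs (hypercube d)" for x y
    using that by (simp only: hypercube_def pair_pre_digraph.simps mem_Collect_eq case_prod_conv
        eq_commute[of "x ! _"])
  then show "symmetric (with_proj (hypercube d))"
    by (simp add: symmetric_def sym_def)
  show "fst e \<noteq> snd e" if "e \<in> parcs (hypercube d)" for e
    using that by (cases e) (auto simp: hypercube_def)
qed (auto simp: hypercube_def)

end

theory Submission
  imports Defs
begin

text \<open>
  The half cube \<open>B = {x. x\<^sub>0 = 0}\<close> works. Let \<open>n = d - 1\<close> and suppose that the forcing process
  started from \<open>B\<close> stalls with the nonempty set \<open>F\<close> of uncolored vertices, viewed as a subset of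
  the opposite half \<open>Q\<^sub>n\<close>. The partner in \<open>B\<close> of each vertex of \<open>F\<close> must be leaky, and so must
  each vertex of \<open>Q\<^sub>n\<close> outside \<open>F\<close> with exactly one neighbor in \<open>F\<close>. If \<open>f(F)\<close> is the number of
  these forced leaks, then \<open>f(F) \<ge> n > d - 2\<close>.

  This isoperimetric inequality is proved by splitting \<open>Q\<^sub>n\<close> into two halves, where
  \<open>f(F) \<ge> f(F\<^sub>0) + f(F\<^sub>1) - |F|\<close>; the induction goes through once strengthened by
  \<open>f(F) \<ge> n + 1\<close> whenever \<open>2|F| \<le> n + 1\<close>.
\<close>

section \<open>Adjacency in the hypercube\<close>

text \<open>Recursion on the first coordinate: two copies of the smaller cube are joined by a
  perfect matching of partners. Every splitting into halves below rests on it.\<close>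

lemma hypercube_arc_Cons_iff:
  "(a # x, b # y) \<in> parcs (hypercube (Suc n)) \<longleftrightarrow>
     (if a = b then (x, y) \<in> parcs (hypercube n) else x = y \<and> length x = n)"
proof (cases "length x = n \<and> length y = n")
  case True
  have "(\<exists>!i. i < Suc n \<and> (a # x) ! i \<noteq> (b # y) ! i) \<longleftrightarrow>
      (if a = b then \<exists>!i. i < n \<and> x ! i \<noteq> y ! i else x = y)"
  proof (cases "a = b")
    case ab: True
    have "(i < Suc n \<and> (a # x) ! i \<noteq> (b # y) ! i) \<longleftrightarrow>
        (\<exists>j. i = Suc j \<and> j < n \<and> x ! j \<noteq> y ! j)" for i
      using ab by (cases i) auto
    then have "(\<exists>!i. i < Suc n \<and> (a # x) ! i \<noteq> (b # y) ! i) \<longleftrightarrow>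
        (\<exists>!i. \<exists>j. i = Suc j \<and> j < n \<and> x ! j \<noteq> y ! j)"
      by simp
    also have "\<dots> \<longleftrightarrow> (\<exists>!i. i < n \<and> x ! i \<noteq> y ! i)"
      by blast
    finally show ?thesis
      using ab by simp
  next
    case ab: False
    \<comment> \<open>Position 0 already differs, so uniqueness means that the tails agree.\<close>
    have "(\<exists>!i. i < Suc n \<and> (a # x) ! i \<noteq> (b # y) ! i) \<longleftrightarrow> (\<forall>i<n. x ! i = y ! i)"
    proof
      assume "\<exists>!i. i < Suc n \<and> (a # x) ! i \<noteq> (b # y) ! i"
      moreover have "0 < Suc n \<and> (a # x) ! 0 \<noteq> (b # y) ! 0"
        using ab by simp
      ultimately have *: "i = 0" if "i < Suc n" "(a # x) ! i \<noteq> (b # y) ! i" for i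
        using that by blast
      show "\<forall>i<n. x ! i = y ! i"
        using *[of "Suc _"] by auto
    next
      assume eq: "\<forall>i<n. x ! i = y ! i"
      show "\<exists>!i. i < Suc n \<and> (a # x) ! i \<noteq> (b # y) ! i"
      proof (rule ex1I[of _ 0])
        show "i = 0" if "i < Suc n \<and> (a # x) ! i \<noteq> (b # y) ! i" for i
          using that eq by (cases i) auto
      qed (use ab in simp)
    qed
    then show ?thesis
      using ab True by (simp add: list_eq_iff_nth_eq)
  qed
  then show ?thesis
    using True by (auto simp: hypercube_def)
qed (auto simp: hypercube_def)

section \<open>Unique neighbors and half cubes\<close>

text \<open>If \<open>F\<close> is the uncolored set, these are the vertices that can force unless
  they are leaky.\<close>

definition unique_neighbors :: "nat \<Rightarrow> bool list set \<Rightarrow> bool list set" where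
  "unique_neighbors n F =
     {v. length v = n \<and> v \<notin> F \<and> (\<exists>u. {w \<in> F. (v, w) \<in> parcs (hypercube n)} = {u})}"

lemma finite_length_eq: "finite {x :: bool list. length x = n}"
  using finite_lists_length_eq[of "UNIV :: bool set" n] by simp

lemma card_length_eq: "card {x :: bool list. length x = n} = 2 ^ n"
  using card_lists_length_eq[of "UNIV :: bool set" n] by simp

lemma finite_unique_neighbors [simp]: "finite (unique_neighbors n F)"
  by (rule finite_subset[OF _ finite_length_eq[of n]]) (auto simp: unique_neighbors_def)

lemma neighbors_Cons:
  assumes "F \<subseteq> {x. length x = Suc n}" "length v = n"
  shows "{w \<in> F. (b # v, w) \<in> parcs (hypercube (Suc n))} =
    Cons b ` {w. b # w \<in> F \<and> (v, w) \<in> parcs (hypercube n)} \<union> {w \<in> F. w = (\<not> b) # v}"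
    (is "?A = ?B")
proof (rule set_eqI)
  fix w
  show "w \<in> ?A \<longleftrightarrow> w \<in> ?B"
  proof (cases w)
    case Nil
    then show ?thesis using assms by auto
  next
    case (Cons c w')
    then show ?thesis
      using assms by (auto simp: hypercube_arc_Cons_iff split: if_splits)
  qed
qed

text \<open>The larger cube gives \<open>b # v\<close> only one extra neighbor, its partner in the
  other half.\<close>

lemma unique_neighbors_Cons:
  assumes "F \<subseteq> {x. length x = Suc n}"
    and "v \<in> unique_neighbors n {x. b # x \<in> F}" "(\<not> b) # v \<notin> F"
  shows "b # v \<in> unique_neighbors (Suc n) F"
proof -
  obtain u where v: "length v = n" "b # v \<notin> F"
    and u: "{w \<in> {x. b # x \<in> F}. (v, w) \<in> parcs (hypercube n)} = {u}"
    using assms(2) by (auto simp: unique_neighbors_def)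
  have "{w \<in> F. (b # v, w) \<in> parcs (hypercube (Suc n))} = {b # u}"
    using assms(3) u unfolding neighbors_Cons[OF assms(1) v(1)] by auto
  then show ?thesis
    using v by (auto simp: unique_neighbors_def)
qed

text \<open>Since \<open>F\<close> misses the half of \<open>b # v\<close>, only the partner can be
  a neighbor in \<open>F\<close>.\<close>

lemma unique_neighbors_Cons_opposite:
  assumes "F \<subseteq> {x. length x = Suc n}"
    and "{x. b # x \<in> F} = {}" "(\<not> b) # v \<in> F"
  shows "b # v \<in> unique_neighbors (Suc n) F"
proof -
  have v: "length v = n" "b # v \<notin> F"
    using assms by auto
  have "{w \<in> F. (b # v, w) \<in> parcs (hypercube (Suc n))} = {(\<not> b) # v}"
    using assms(2,3) unfolding neighbors_Cons[OF assms(1) v(1)] by auto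
  then show ?thesis
    using v by (auto simp: unique_neighbors_def)
qed

lemma card_split_head:
  assumes "F \<subseteq> {x. length x = Suc n}"
  shows "card F = card {x. b # x \<in> F} + card {x. (\<not> b) # x \<in> F}"
proof -
  have "finite F"
    using assms finite_length_eq by (rule finite_subset)
  then have fin: "finite {x. c # x \<in> F}" for c
    using finite_vimageI[of F "Cons c"] by (simp add: vimage_def)
  have "x \<in> Cons b ` {x. b # x \<in> F} \<union> Cons (\<not> b) ` {x. (\<not> b) # x \<in> F}" if "x \<in> F" for x
    using that assms by (cases x; cases "hd x = b") auto
  then have "F = Cons b ` {x. b # x \<in> F} \<union> Cons (\<not> b) ` {x. (\<not> b) # x \<in> F}"
    by auto
  then have "card F = card (Cons b ` {x. b # x \<in> F} \<union> Cons (\<not> b) ` {x. (\<not> b) # x \<in> F})"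
    by simp
  also have "\<dots> = card (Cons b ` {x. b # x \<in> F}) + card (Cons (\<not> b) ` {x. (\<not> b) # x \<in> F})"
    using fin by (intro card_Un_disjoint) auto
  finally show ?thesis
    by (simp add: card_image)
qed

text \<open>A unique neighbor within the half is lost only if its partner lies in \<open>F\<close>,
  so the losses are bounded by the size of the opposite slice.\<close>

lemma card_unique_neighbors_Cons:
  assumes "F \<subseteq> {x. length x = Suc n}"
  shows "card (unique_neighbors n {x. b # x \<in> F}) - card {x. (\<not> b) # x \<in> F}
    \<le> card {v. b # v \<in> unique_neighbors (Suc n) F}"
proof -
  have "card (unique_neighbors n {x. b # x \<in> F}) - card {x. (\<not> b) # x \<in> F}
      \<le> card (unique_neighbors n {x. b # x \<in> F} - {x. (\<not> b) # x \<in> F})"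
  proof (rule diff_card_le_card_Diff)
    show "finite {x. (\<not> b) # x \<in> F}"
      by (rule finite_subset[OF _ finite_length_eq[of n]]) (use assms in auto)
  qed
  also have "\<dots> \<le> card {v. b # v \<in> unique_neighbors (Suc n) F}"
  proof (rule card_mono)
    show "finite {v. b # v \<in> unique_neighbors (Suc n) F}"
      by (rule finite_subset[OF _ finite_length_eq[of n]]) (auto simp: unique_neighbors_def)
    show "unique_neighbors n {x. b # x \<in> F} - {x. (\<not> b) # x \<in> F}
        \<subseteq> {v. b # v \<in> unique_neighbors (Suc n) F}"
      using unique_neighbors_Cons[OF assms] by blast
  qed
  finally show ?thesis .
qed

section \<open>The isoperimetric inequality\<close>

text \<open>The first bound alone is not inductive: two nonempty halves would give
  \<open>2 * n - card F\<close>, only \<open>n\<close> when \<open>card F = n\<close>. The second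
  clause supplies the missing unit.\<close>

lemma card_unique_neighbors:
  assumes "F \<subseteq> {x. length x = n}" "F \<noteq> {}"
  shows "n \<le> card F + card (unique_neighbors n F) \<and>
    (2 * card F \<le> n + 1 \<longrightarrow> n + 1 \<le> card F + card (unique_neighbors n F))"
  using assms
proof (induction n arbitrary: F)
  case 0
  then have "finite F"
    using finite_length_eq finite_subset by blast
  then show ?case
    using 0 by (simp add: card_gt_0_iff Suc_le_eq)
next
  case (Suc n)
  define H where "H b = {x. b # x \<in> F}" for b
  have sub: "H b \<subseteq> {x. length x = n}" for b
    using Suc.prems by (auto simp: H_def)
  have fin: "finite (H b)" for b
    using sub finite_length_eq by (rule finite_subset)
  define f where "f b = card (H b) + card (unique_neighbors n (H b))" for b
  have IH: "n \<le> f b" "2 * card (H b) \<le> n + 1 \<Longrightarrow> n + 1 \<le> f b" if "H b \<noteq> {}" for b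
    using Suc.IH[OF sub that] by (auto simp: f_def)
  \<comment> \<open>The lighter half satisfies \<open>2 * card (H b) \<le> card F\<close>, so the
    sharper hypothesis applies to it whenever \<open>card F \<le> n + 1\<close>.\<close>
  obtain b where b: "card (H b) \<le> card (H (\<not> b))"
    by (cases "card (H True) \<le> card (H False)") (use that[of True] that[of False] in auto)
  have cardF: "card F = card (H b) + card (H (\<not> b))"
    using card_split_head[OF Suc.prems(1)] by (simp add: H_def)
  have cardF_pos: "card F > 0"
    using Suc.prems finite_subset[OF _ finite_length_eq] by (auto simp: card_gt_0_iff)
  let ?U = "\<lambda>b. {v. b # v \<in> unique_neighbors (Suc n) F}"
  have cardU: "card (unique_neighbors (Suc n) F) = card (?U b) + card (?U (\<not> b))"
    by (rule card_split_head) (auto simp: unique_neighbors_def)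
  have U: "card (unique_neighbors n (H c)) - card (H (\<not> c)) \<le> card (?U c)" for c
    using card_unique_neighbors_Cons[OF Suc.prems(1)] by (simp add: H_def)
  show ?case
  proof (cases "H b = {}")
    case True
    then have "H (\<not> b) \<subseteq> ?U b"
      using unique_neighbors_Cons_opposite[OF Suc.prems(1)] by (auto simp: H_def)
    moreover have "finite (?U b)"
      by (rule finite_subset[OF _ finite_length_eq[of n]]) (auto simp: unique_neighbors_def)
    ultimately have "card (H (\<not> b)) \<le> card (?U b)"
      by (rule card_mono[rotated])
    moreover have "card (unique_neighbors n (H (\<not> b))) \<le> card (?U (\<not> b))"
      using U[of "\<not> b"] True by simp
    moreover have ne: "H (\<not> b) \<noteq> {}"
      using cardF cardF_pos True by auto
    \<comment> \<open>The sum is at least \<open>card F + f (\<not> b)\<close>. For the sharper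
      bound \<open>n + 2\<close>, either \<open>card F \<ge> 2\<close>, or \<open>card F = 1\<close>
      and \<open>f (\<not> b) \<ge> n + 1\<close>, by the second clause if \<open>n > 0\<close> and
      by \<open>card (H (\<not> b)) = 1\<close> if \<open>n = 0\<close>.\<close>
    ultimately show ?thesis
      using IH[OF ne] cardF cardU cardF_pos True by (auto simp: f_def)
  next
    case False
    then have pos: "card (H b) > 0"
      using fin by (simp add: card_gt_0_iff)
    then have ne: "H (\<not> b) \<noteq> {}"
      using b by auto
    have "f b + f (\<not> b) \<le> card F + (card F + card (unique_neighbors (Suc n) F))"
      using U[of b] U[of "\<not> b"] cardF cardU by (simp add: f_def)
    \<comment> \<open>If \<open>card F \<ge> n + 1\<close>, the first bound is immediate; otherwise
      the sum is at least \<open>(n + 1) + n - card F \<ge> n + 1\<close>. If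
      \<open>2 * card F \<le> n + 2\<close>, both slices are small enough for the sharper
      hypothesis, and \<open>card F \<ge> 2\<close> forces \<open>n \<ge> 2\<close>, so
      \<open>2 * (n + 1) - card F \<ge> n + 2\<close>.\<close>
    then show ?thesis
      using IH[OF False] IH[OF ne] b pos cardF by linarith
  qed
qed

section \<open>Stalled forcing processes and the half cube\<close>

text \<open>Each force shrinks the finite uncolored set, so the process must stop.\<close>

lemma (in pair_graph) forcing_process_stalls:
  assumes "S \<subseteq> pverts G"
  shows "\<exists>T. (force_step G L)\<^sup>*\<^sup>* S T \<and> S \<subseteq> T \<and> T \<subseteq> pverts G \<and> (\<nexists>v u. forces G L T v u)"
  using assms
proof (induction "card (pverts G - S)" arbitrary: S rule: less_induct)
  case less
  show ?case
  proof (cases "\<exists>v u. forces G L S v u")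
    case True
    then obtain v u where vu: "forces G L S v u"
      by blast
    then have "(v, u) \<in> parcs G" and u: "u \<notin> S"
      by (auto simp: forces_def)
    then have uV: "u \<in> pverts G"
      using in_arcsD2 by blast
    have "card (pverts G - insert u S) < card (pverts G - S)"
      by (rule psubset_card_mono) (use uV u in auto)
    from less.hyps[OF this] obtain T where
      "(force_step G L)\<^sup>*\<^sup>* (insert u S) T" "insert u S \<subseteq> T" "T \<subseteq> pverts G"
      "\<nexists>v u. forces G L T v u"
      using less.prems uV by auto
    moreover have "force_step G L S (insert u S)"
      using vu by (rule force_step.intros)
    ultimately show ?thesis
      by (metis converse_rtranclp_into_rtranclp insert_subset)
  next
    case False
    then show ?thesis
      using less.prems by blast
  qed
qed

lemma leaky_forcing_set_half_cube:
  assumes "l < n"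
  shows "leaky_forcing_set l (hypercube (Suc n)) (Cons False ` {x. length x = n})"
    (is "leaky_forcing_set l ?G ?B")
  unfolding leaky_forcing_set_def
proof (intro conjI allI impI)
  show B: "?B \<subseteq> pverts ?G"
    by (auto simp: hypercube_def)
  fix L
  assume L: "L \<subseteq> pverts ?G" "card L \<le> l"
  interpret pair_graph ?G
    by (rule pair_graph_hypercube)
  obtain T where T: "(force_step ?G L)\<^sup>*\<^sup>* ?B T" "?B \<subseteq> T" "T \<subseteq> pverts ?G"
    and stalled: "\<nexists>v u. forces ?G L T v u"
    using forcing_process_stalls[OF B] by blast
  define W where "W = pverts ?G - T"
  define F where "F = {x. True # x \<in> W}"
  have W: "W \<subseteq> {x. length x = Suc n}" and F: "F \<subseteq> {x. length x = n}"
    by (auto simp: W_def F_def hypercube_def)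
  have FW: "{x. False # x \<in> W} = {}"
    using T(2) by (auto simp: W_def hypercube_def)
  \<comment> \<open>Without a leak, \<open>v\<close> would force its unique uncolored neighbor, and
    the process would not be stalled.\<close>
  have leak: "v \<in> L" if "v \<in> unique_neighbors (Suc n) W" for v
  proof (rule ccontr)
    assume "v \<notin> L"
    moreover have "v \<in> T"
      using that by (auto simp: unique_neighbors_def W_def hypercube_def)
    moreover obtain u where "{w \<in> W. (v, w) \<in> parcs ?G} = {u}"
      using \<open>v \<in> unique_neighbors (Suc n) W\<close> by (auto simp: unique_neighbors_def)
    moreover have "{w. (v, w) \<in> parcs ?G \<and> w \<notin> T} = {w \<in> W. (v, w) \<in> parcs ?G}"
      by (auto simp: W_def hypercube_def)
    ultimately show False
      using stalled by (auto simp: forces_def)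
  qed
  have "F = {}"
  proof (rule ccontr)
    assume "F \<noteq> {}"
    have finF: "finite F"
      using F finite_length_eq by (rule finite_subset)
    have "n \<le> card F + card (unique_neighbors n F)"
      using card_unique_neighbors[OF F \<open>F \<noteq> {}\<close>] by blast
    also have "\<dots> = card (Cons False ` F) + card (Cons True ` unique_neighbors n F)"
      by (simp add: card_image)
    also have "\<dots> = card (Cons False ` F \<union> Cons True ` unique_neighbors n F)"
      by (rule card_Un_disjoint[symmetric]) (use finF in auto)
    also have "\<dots> \<le> card L"
    proof (rule card_mono)
      show "finite L"
        by (rule finite_subset[OF L(1)]) (simp add: hypercube_def finite_length_eq)
      \<comment> \<open>Both families are unique neighbors of \<open>W\<close>, because the half
        with head \<open>False\<close> stays colored: its vertices see \<open>W\<close> only through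
        their partners, and those partners add nothing to the counts in the other half.\<close>
      show "Cons False ` F \<union> Cons True ` unique_neighbors n F \<subseteq> L"
        using unique_neighbors_Cons_opposite[OF W FW] unique_neighbors_Cons[OF W, of _ True] FW
        by (auto simp: F_def intro!: leak)
    qed
    finally show False
      using L(2) assms by simp
  qed
  have "x \<notin> W" for x
  proof (cases x)
    case (Cons c y)
    then show ?thesis
      using \<open>F = {}\<close> FW by (cases c) (auto simp: F_def)
  qed (use W in auto)
  then have "T = pverts ?G"
    using T(3) by (auto simp: W_def)
  then show "(force_step ?G L)\<^sup>*\<^sup>* ?B (pverts ?G)"
    using T(1) by simp
qed

theorem theorem1p1:
  fixes d :: nat
  assumes "d \<ge> 2"
  shows "leaky_forcing_number (d - 2) (hypercube d) \<le> 2 ^ (d - 1)"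
proof -
  \<comment> \<open>As subtraction is truncated, \<open>d \<ge> 2\<close> is what gives
    \<open>d - 2 < d - 1\<close>.\<close>
  have "leaky_forcing_set (d - 2) (hypercube d) (Cons False ` {x. length x = d - 1})"
    using leaky_forcing_set_half_cube[of "d - 2" "d - 1"] assms by simp
  moreover have "card (Cons False ` {x. length x = d - 1}) = 2 ^ (d - 1)"
    by (simp add: card_image card_length_eq)
  ultimately show ?thesis
    unfolding leaky_forcing_number_def by (intro Least_le) blast
qed

end
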